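(* Consider the power network with first-order turbine dynamics described in the context, with parameters proportional to rating: $m_i=f_im$, $d_i=f_id$, $r_i^{-1}=f_ir^{-1}$, $\tau_i=\tau$, where $f_i>0$ and $m,d,r,\tau>0$, subject to the step disturbance $u(t)=u_0\mathbf{1}_{t\ge0}$. Then, under the under-damped condition $$\frac{d+r^{-1}}{m\tau}-\frac14\left(\frac1\tau+\frac dm\right)^2>0,$$ the RoCoF (maximum rate of change of the system frequency $\bar w$) is $$\|\dot{\bar w}\|_\infty=\frac{\left|\sum_iu_{0i}\right|}{\sum_if_i}\,\frac1m.$$
   Context: There are $n$ generator buses with phase angles $\theta_i$, frequencies $w_i$ and turbine powers $q_i$ (deviations from equilibrium) satisfying $$\dot\theta_i=w_i,\qquad m_i\dot w_i=-d_iw_i+q_i+u_i-p^e_i,\qquad \tau_i\dot q_i=-r_i^{-1}w_i-q_i,$$ with zero initial conditions, where $p^e=L\theta$ and $L\in\mathbb{R}^{n\times n}$ is a symmetric positive semidefinite weighted graph Laplacian of rank $n-1$ with kernel spanned by the all-ones vector. Equivalently, bus $i$ has transfer function from net power $u_i-p_i^e$ to $\theta_i$ given by $g_i(s)=\frac{\tau_is+1}{s(m_i\tau_is^2+(m_i+d_i\tau_i)s+d_i+r_i^{-1})}$, and the proportionality of parameters means $g_i(s)=\frac1{f_i}g_0(s)$ with the representative machine $g_0(s)=\frac{\tau s+1}{s(m\tau s^2+(m+d\tau)s+d+r^{-1})}$. The disturbance is a step in a fixed direction $u_0=(u_{01},\dots,u_{0n})\in\mathbb{R}^n$. The system frequency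 is $\bar w(t):=\frac{\sum_if_iw_i(t)}{\sum_if_i}$, and $\|\dot{\bar w}\|_\infty:=\sup_{t>0}|\dot{\bar w}(t)|$ (the value at $t=0$ being understood as the right limit $t\to0^+$). *)

theory Defs
  imports "HOL-Analysis.Analysis"
begin

text \<open>
  No sign is imposed on the edge weights: the Laplacian of a linearised power flow may have
  negative weights, and positive semidefiniteness is a separate hypothesis below.
\<close>

definition weighted_graph_laplacian :: "real^'n^'n \<Rightarrow> bool" where
  "weighted_graph_laplacian L \<longleftrightarrow>
     (\<exists>A. (\<forall>i j. A i j = A j i) \<and> (\<forall>i. A i i = 0) \<and>
          L = (\<chi> i j. if i = j then (\<Sum>k\<in>UNIV. A i k) else - A i j))"

definition positive_semidefinite :: "real^'n^'n \<Rightarrow> bool" where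
  "positive_semidefinite M \<longleftrightarrow> (\<forall>x. 0 \<le> x \<bullet> (M *v x))"

definition network_laplacian :: "real^'n^'n \<Rightarrow> bool" where
  "network_laplacian L \<longleftrightarrow>
     weighted_graph_laplacian L \<and> transpose L = L \<and> positive_semidefinite L \<and>
     rank L = CARD('n) - 1 \<and> {x. L *v x = 0} = span {\<chi> i. 1}"

definition step_disturbance :: "real^'n \<Rightarrow> real \<Rightarrow> real^'n" where
  "step_disturbance u\<^sub>0 t = (if 0 \<le> t then u\<^sub>0 else 0)"

text \<open>
  Trajectories matter only on \<open>[0, \<infinity>)\<close>; at \<open>t = 0\<close> the derivatives are right derivatives.
\<close>

definition turbine_network_response ::
  "real^'n \<Rightarrow> real^'n \<Rightarrow> real^'n \<Rightarrow> real^'n \<Rightarrow> real^'n^'n \<Rightarrow> (real \<Rightarrow> real^'n) \<Rightarrow>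
   (real \<Rightarrow> real^'n) \<Rightarrow> (real \<Rightarrow> real^'n) \<Rightarrow> (real \<Rightarrow> real^'n) \<Rightarrow> bool" where
  "turbine_network_response ms ds rs \<tau>s L u \<theta> w q \<longleftrightarrow>
     \<theta> 0 = 0 \<and> w 0 = 0 \<and> q 0 = 0 \<and>
     (\<forall>t\<ge>0. \<forall>i.
        ((\<lambda>t. \<theta> t $ i) has_real_derivative w t $ i) (at t within {0..}) \<and>
        ((\<lambda>t. w t $ i) has_real_derivative
           (- ds $ i * w t $ i + q t $ i + u t $ i - (L *v \<theta> t) $ i) / ms $ i)
          (at t within {0..}) \<and>
        ((\<lambda>t. q t $ i) has_real_derivative
           (- inverse (rs $ i) * w t $ i - q t $ i) / \<tau>s $ i)
          (at t within {0..}))"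

definition system_frequency :: "real^'n \<Rightarrow> (real \<Rightarrow> real^'n) \<Rightarrow> real \<Rightarrow> real" where
  "system_frequency f w t = (\<Sum>i\<in>UNIV. f $ i * w t $ i) / (\<Sum>i\<in>UNIV. f $ i)"

text \<open>
  The supremum is taken in the extended reals, so that a finite value entails boundedness.
  When \<open>g\<close> has a right limit at \<open>0\<close>, including that limit as the value at \<open>0\<close> does not
  change the supremum.
\<close>

definition sup_norm_pos :: "(real \<Rightarrow> real) \<Rightarrow> ereal" where
  "sup_norm_pos g = (SUP t\<in>{0<..}. ereal \<bar>g t\<bar>)"

definition rocof :: "real^'n \<Rightarrow> (real \<Rightarrow> real^'n) \<Rightarrow> ereal" where
  "rocof f w = sup_norm_pos (deriv (system_frequency f w))"

end

theory Submission
  imports Defs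
begin

text \<open>
  Summing the bus equations eliminates the network, since the all-ones vector is in the kernel
  of the symmetric \<open>L\<close>. The aggregate acceleration \<open>a\<close> and the aggregate turbine ramp \<open>p\<close>
  then satisfy \<open>m a' = - d a + p\<close> and \<open>\<tau> p' = - \<rho> a - p\<close> with \<open>p 0 = 0\<close>, where \<open>\<rho> = 1 / r\<close>.
  The energy \<open>m a\<^sup>2 + (\<tau> / \<rho>) p\<^sup>2\<close> is nonincreasing, so \<open>\<bar>a\<bar>\<close> never exceeds its initial value,
  which the right limit at \<open>0\<close> attains.
\<close>

text \<open>The sum is the inner product of \<open>L *v x\<close> with the all-ones vector; symmetry
  moves \<open>L\<close> onto that vector, which it kills.\<close>

lemma network_laplacian_sum_eq_0:
  fixes L :: "real^'n^'n"
  assumes "network_laplacian L"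
  shows "(\<Sum>i\<in>UNIV. (L *v x) $ i) = 0"
proof -
  define e :: "real^'n" where "e = (\<chi> i. 1)"
  have "e \<in> {x. L *v x = 0}"
    using assms unfolding network_laplacian_def e_def by (metis span_base singletonI)
  then have "L *v e = 0" by simp
  moreover have "transpose L = L"
    using assms by (simp add: network_laplacian_def)
  ultimately have "e \<bullet> (L *v x) = 0"
    by (metis dot_lmul_matrix inner_zero_left vector_transpose_matrix)
  then show ?thesis
    by (simp add: e_def inner_vec_def)
qed

lemma turbine_energy_bound:
  fixes a p :: "real \<Rightarrow> real"
  assumes pos: "m > 0" "d > 0" "\<rho> > 0" "\<tau> > 0"
    and a: "\<And>t. t \<ge> 0 \<Longrightarrow> (a has_real_derivative (- d * a t + p t) / m) (at t within {0..})"
    and p: "\<And>t. t \<ge> 0 \<Longrightarrow> (p has_real_derivative (- \<rho> * a t - p t) / \<tau>) (at t within {0..})"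
    and "p 0 = 0" and "t \<ge> 0"
  shows "\<bar>a t\<bar> \<le> \<bar>a 0\<bar>"
proof (cases "t = 0")
  case False
  \<comment> \<open>The weight \<open>\<tau> / \<rho>\<close> makes the cross terms
    \<open>2 * a * p\<close> and \<open>- 2 * a * p\<close> cancel in the derivative, leaving only
    dissipation.\<close>
  define E where "E t = m * (a t)\<^sup>2 + \<tau> / \<rho> * (p t)\<^sup>2" for t
  have E: "(E has_real_derivative - 2 * d * (a s)\<^sup>2 - 2 / \<rho> * (p s)\<^sup>2) (at s within {0..})"
    if "s \<ge> 0" for s
    unfolding E_def using pos
    by (auto intro!: derivative_eq_intros a[OF that] p[OF that]
        simp: field_simps power2_eq_square)
  have "E t \<le> E 0"
  \<comment> \<open>Two-sided derivatives exist only for positive times, so the open-interval form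
    is used and continuity covers the endpoint \<open>0\<close>.\<close>
  proof (rule DERIV_nonpos_imp_decreasing_open[where f = E])
    fix s :: real
    assume "0 < s"
    then have "at s within {0..} = at s"
      by (intro at_within_interior) simp
    moreover have "0 \<le> 2 * d * (a s)\<^sup>2" "0 \<le> 2 / \<rho> * (p s)\<^sup>2"
      using pos by simp_all
    then have "- 2 * d * (a s)\<^sup>2 - 2 / \<rho> * (p s)\<^sup>2 \<le> 0"
      by simp
    ultimately show "\<exists>y. (E has_real_derivative y) (at s) \<and> y \<le> 0"
      using E[of s] \<open>0 < s\<close> by auto
  next
    have "continuous_on {0..} E"
      using E by (intro DERIV_continuous_on) auto
    then show "continuous_on {0..t} E"
      by (rule continuous_on_subset) auto
  qed (use \<open>t \<ge> 0\<close> in simp)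
  moreover have "m * (a t)\<^sup>2 \<le> E t"
    using pos by (simp add: E_def)
  moreover have "E 0 = m * (a 0)\<^sup>2"
    using \<open>p 0 = 0\<close> by (simp add: E_def)
  ultimately have "(a t)\<^sup>2 \<le> (a 0)\<^sup>2"
    using pos by (smt (verit) mult_le_cancel_left_pos)
  then show ?thesis
    by (simp add: abs_le_square_iff)
qed simp

text \<open>The supremum omits \<open>0\<close>, so the lower bound comes from the right limit.
  \<open>g\<close> is kept apart from \<open>a\<close> because it will be a two-sided
  \<open>deriv\<close>, uncontrolled at \<open>0\<close> when nothing is known for negative
  times.\<close>

lemma sup_norm_pos_eq_initial:
  fixes a g :: "real \<Rightarrow> real"
  assumes "continuous_on {0..} a"
    and "\<And>t. t \<ge> 0 \<Longrightarrow> \<bar>a t\<bar> \<le> \<bar>a 0\<bar>"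
    and "\<And>t. t > 0 \<Longrightarrow> g t = a t"
  shows "sup_norm_pos g = ereal \<bar>a 0\<bar>"
proof (rule antisym)
  show "sup_norm_pos g \<le> ereal \<bar>a 0\<bar>"
    unfolding sup_norm_pos_def using assms(2,3) by (intro SUP_least) auto
next
  have "(a \<longlongrightarrow> a 0) (at 0 within {0..})"
    using assms(1) by (auto simp: continuous_on_def)
  then have "(a \<longlongrightarrow> a 0) (at_right 0)"
    by (rule tendsto_within_subset) auto
  then have "((\<lambda>t. ereal \<bar>a t\<bar>) \<longlongrightarrow> ereal \<bar>a 0\<bar>) (at_right 0)"
    by (intro tendsto_intros)
  moreover have "\<forall>\<^sub>F t in at_right 0. ereal \<bar>a t\<bar> \<le> sup_norm_pos g"
    unfolding sup_norm_pos_def eventually_at_right_field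
    using assms(3) by (metis SUP_upper greaterThan_iff zero_less_one)
  ultimately show "ereal \<bar>a 0\<bar> \<le> sup_norm_pos g"
    by (rule tendsto_upperbound) simp
qed

text \<open>Differentiating the two equations once removes the constant forcing \<open>U\<close>, so
  the derivatives of \<open>W\<close> and \<open>Q\<close> obey the homogeneous system of the energy
  bound, starting from \<open>U / m\<close> and \<open>0\<close>.\<close>

lemma aggregate_rocof:
  fixes W Q :: "real \<Rightarrow> real"
  assumes pos: "m > 0" "d > 0" "\<rho> > 0" "\<tau> > 0"
    and init: "W 0 = 0" "Q 0 = 0"
    and W: "\<And>t. t \<ge> 0 \<Longrightarrow>
      (W has_real_derivative (- d * W t + Q t + U) / m) (at t within {0..})"
    and Q: "\<And>t. t \<ge> 0 \<Longrightarrow>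
      (Q has_real_derivative (- \<rho> * W t - Q t) / \<tau>) (at t within {0..})"
  shows "sup_norm_pos (deriv W) = ereal (\<bar>U\<bar> / m)"
proof -
  define a where "a t = (- d * W t + Q t + U) / m" for t
  define p where "p t = (- \<rho> * W t - Q t) / \<tau>" for t
  have W': "(W has_real_derivative a t) (at t within {0..})" if "t \<ge> 0" for t
    using W[OF that] by (simp add: a_def)
  have Q': "(Q has_real_derivative p t) (at t within {0..})" if "t \<ge> 0" for t
    using Q[OF that] by (simp add: p_def)
  have da: "(a has_real_derivative (- d * a t + p t) / m) (at t within {0..})"
    if "t \<ge> 0" for t
    unfolding a_def[abs_def] using pos
    by (auto intro!: derivative_eq_intros W'[OF that] Q'[OF that] simp: a_def)
  have dp: "(p has_real_derivative (- \<rho> * a t - p t) / \<tau>) (at t within {0..})"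
    if "t \<ge> 0" for t
    unfolding p_def[abs_def] using pos
    by (auto intro!: derivative_eq_intros W'[OF that] Q'[OF that] simp: p_def)
  have "p 0 = 0"
    using init by (simp add: p_def)
  have "sup_norm_pos (deriv W) = ereal \<bar>a 0\<bar>"
  proof (rule sup_norm_pos_eq_initial)
    show "continuous_on {0..} a"
      using da by (intro DERIV_continuous_on) auto
    show "\<bar>a t\<bar> \<le> \<bar>a 0\<bar>" if "t \<ge> 0" for t
      using turbine_energy_bound[OF pos da dp \<open>p 0 = 0\<close> that] .
    show "deriv W t = a t" if "t > 0" for t
    proof -
      have "at t within {0..} = at t"
        using that by (intro at_within_interior) simp
      with W'[of t] that show ?thesis
        by (simp add: DERIV_imp_deriv)
    qed
  qed
  then show ?thesis
    using init pos by (simp add: a_def)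
qed

theorem proposition5:
  fixes f ms ds rs \<tau>s u\<^sub>0 :: "real^'n"
    and L :: "real^'n^'n"
    and m d r \<tau> :: real
    and \<theta> w q :: "real \<Rightarrow> real^'n"
  assumes "m > 0" and "d > 0" and "r > 0" and "\<tau> > 0"
    and "\<And>i. f $ i > 0"
    and "\<And>i. ms $ i = f $ i * m"
    and "\<And>i. ds $ i = f $ i * d"
    and "\<And>i. inverse (rs $ i) = f $ i * inverse r"
    and "\<And>i. \<tau>s $ i = \<tau>"
    and "network_laplacian L"
    and "turbine_network_response ms ds rs \<tau>s L (step_disturbance u\<^sub>0) \<theta> w q"
    and "(d + inverse r) / (m * \<tau>) - 1 / 4 * (1 / \<tau> + d / m)\<^sup>2 > 0"
  shows "rocof f w = ereal (\<bar>\<Sum>i\<in>UNIV. u\<^sub>0 $ i\<bar> / (\<Sum>i\<in>UNIV. f $ i) * (1 / m))"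
proof -
  define F where "F = (\<Sum>i\<in>UNIV. f $ i)"
  have "F > 0"
    unfolding F_def using assms(5) by (intro sum_pos) auto
  \<comment> \<open>Turbine powers already scale with rating, so the plain sum over \<open>F\<close>
    is the counterpart of the \<open>f\<close>-weighted mean frequency.\<close>
  define Q where "Q t = (\<Sum>i\<in>UNIV. q t $ i) / F" for t
  define U where "U = (\<Sum>i\<in>UNIV. u\<^sub>0 $ i) / F"
  have W_def: "system_frequency f w = (\<lambda>t. (\<Sum>i\<in>UNIV. f $ i * w t $ i) / F)"
    by (simp add: system_frequency_def F_def fun_eq_iff)
  note resp = assms(11)[unfolded turbine_network_response_def]
  have dw: "((\<lambda>t. w t $ i) has_real_derivative
      (- (f $ i * d) * w t $ i + q t $ i + u\<^sub>0 $ i - (L *v \<theta> t) $ i) / (f $ i * m))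
      (at t within {0..})" if "t \<ge> 0" for t i
    using resp that by (simp add: assms(6,7) step_disturbance_def)
  have dq: "((\<lambda>t. q t $ i) has_real_derivative
      (- (f $ i * inverse r) * w t $ i - q t $ i) / \<tau>) (at t within {0..})"
    if "t \<ge> 0" for t i
    using resp that by (simp add: assms(8,9))
  have "sup_norm_pos (deriv (system_frequency f w)) = ereal (\<bar>U\<bar> / m)"
  proof (rule aggregate_rocof)
    show "m > 0" "d > 0" "inverse r > 0" "\<tau> > 0"
      using assms(1-4) by auto
    show "system_frequency f w 0 = 0" "Q 0 = 0"
      using resp by (simp_all add: system_frequency_def Q_def)
  next
    fix t :: real
    assume "t \<ge> 0"
    have "(system_frequency f w has_real_derivative
      (\<Sum>i\<in>UNIV. f $ i * ((- (f $ i * d) * w t $ i + q t $ i + u\<^sub>0 $ i - (L *v \<theta> t) $ i)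
        / (f $ i * m))) / F) (at t within {0..})"
      unfolding W_def by (intro DERIV_cdivide DERIV_sum DERIV_cmult dw \<open>t \<ge> 0\<close>)
    \<comment> \<open>The averaging weight \<open>f $ i\<close> cancels the rating in the inertia
      \<open>f $ i * m\<close>, leaving the common factor \<open>1 / m\<close>; the damping keeps
      its rating and reproduces the weighted frequency.\<close>
    also have "(\<Sum>i\<in>UNIV. f $ i * ((- (f $ i * d) * w t $ i + q t $ i + u\<^sub>0 $ i
        - (L *v \<theta> t) $ i) / (f $ i * m)))
      = (\<Sum>i\<in>UNIV. (- d * (f $ i * w t $ i) + q t $ i + u\<^sub>0 $ i - (L *v \<theta> t) $ i) / m)"
      using assms(5) by (intro sum.cong) (auto simp: less_imp_neq[symmetric] mult.assoc mult.left_commute)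
    also have "\<dots> = (- d * (\<Sum>i\<in>UNIV. f $ i * w t $ i) + (\<Sum>i\<in>UNIV. q t $ i)
        + (\<Sum>i\<in>UNIV. u\<^sub>0 $ i)) / m"
      by (simp only: sum_divide_distrib[symmetric] sum.distrib sum_subtractf
          sum_distrib_left[symmetric] network_laplacian_sum_eq_0[OF assms(10)] diff_0_right)
    also have "\<dots> / F = (- d * system_frequency f w t + Q t + U) / m"
      using \<open>F > 0\<close> \<open>m > 0\<close> by (simp add: W_def Q_def U_def field_simps)
    finally show "(system_frequency f w has_real_derivative
      (- d * system_frequency f w t + Q t + U) / m) (at t within {0..})" .
  next
    fix t :: real
    assume "t \<ge> 0"
    have "(Q has_real_derivative
      (\<Sum>i\<in>UNIV. (- (f $ i * inverse r) * w t $ i - q t $ i) / \<tau>) / F) (at t within {0..})"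
      unfolding Q_def[abs_def] by (intro DERIV_cdivide DERIV_sum dq \<open>t \<ge> 0\<close>)
    \<comment> \<open>A common \<open>\<tau>\<close> factors out of the sum, and the rating in the
      droop gain supplies the frequency weights, so the averaged turbine equation closes.\<close>
    also have "(\<Sum>i\<in>UNIV. (- (f $ i * inverse r) * w t $ i - q t $ i) / \<tau>)
      = (\<Sum>i\<in>UNIV. - inverse r * (f $ i * w t $ i) - q t $ i) / \<tau>"
      by (simp add: sum_divide_distrib mult.assoc mult.left_commute)
    also have "\<dots> = (- inverse r * (\<Sum>i\<in>UNIV. f $ i * w t $ i) - (\<Sum>i\<in>UNIV. q t $ i)) / \<tau>"
      by (simp only: sum_subtractf sum_distrib_left[symmetric])
    also have "\<dots> / F = (- inverse r * system_frequency f w t - Q t) / \<tau>"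
      using \<open>F > 0\<close> \<open>\<tau> > 0\<close> \<open>r > 0\<close> by (simp add: W_def Q_def field_simps)
    finally show "(Q has_real_derivative
      (- inverse r * system_frequency f w t - Q t) / \<tau>) (at t within {0..})" .
  qed
  then show ?thesis
    using \<open>F > 0\<close> by (simp add: rocof_def U_def F_def abs_divide)
qed

end
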